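(* Let $\{x^k\}$ be a sequence generated by the Riemannian generalized conditional gradient method with the Armijo step size, and suppose that the sequence is infinite, i.e. $\theta(x^k)<0$ for all $k$. Assume that $f$ is $L$-smooth with constant $L>0$; that $\Omega>0$ satisfies $\Omega\ge\|R_{x^i}^{-1}(x^j)\|_{x^i}$ for all $i,j$ and $\Omega\ge\operatorname{diam}(\mathcal{X})$; and that $g$ is Lipschitz continuous on $\mathcal{X}$ with constant $L_g>0$, namely $|g(x)-g(y)|\le L_g\|R_x^{-1}(y)\|_x$ for all $x,y\in\mathcal{X}$. Define $$\rho:=\sup\{\|\operatorname{grad}f(x)\|_x\mid x\in\mathcal{X}\},\qquad \gamma:=\min\left\{\frac{1}{(L_g+\rho)\Omega},\frac{2\omega_1(1-\zeta)}{L\Omega^2}\right\}.$$ Then $\lim_{k\to\infty}F(x^k)=F(x^* )$ for some $x^*\in\mathcal{X}$. Moreover, the following statements hold: (1) $\lim_{k\to\infty}\theta(x^k)=0$; (2) $\min\{|\theta(x^k)|\mid k=0,1,\ldots,N-1\}\le\sqrt{\dfrac{F(x^0)-F(x^* )}{\zeta\gamma N}}$ for every integer $N\ge1$.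
   Context: Setting. $\mathcal{M}$ is a Riemannian manifold with metric $\langle\cdot,\cdot\rangle_x$, norm $\|\cdot\|_x$ on $T_x\mathcal{M}$, and Riemannian distance $\operatorname{dist}$. $R:T\mathcal{M}\to\mathcal{M}$ is a retraction, i.e. a smooth map whose restrictions $R_x:T_x\mathcal{M}\to\mathcal{M}$ satisfy $R_x(0_x)=x$ and $\mathrm{D}R_x(0_x)=\operatorname{id}_{T_x\mathcal{M}}$. A set $\mathcal{S}\subseteq\mathcal{M}$ is $R$-convex if for all $x,y\in\mathcal{S}$ for which $R_x^{-1}(y)$ is well-defined, $R_x(tR_x^{-1}(y))\in\mathcal{S}$ for all $t\in[0,1]$. A function $h:\mathcal{M}\to\mathbb{R}$ is $R$-convex if for all $x,y$ for which $R_x^{-1}(y)$ is well-defined and all $\lambda\in[0,1]$, $h(R_x(\lambda R_x^{-1}(y)))\le(1-\lambda)h(x)+\lambda h(y)$. A differentiable function $h:\mathcal{M}\to\mathbb{R}$ is $L$-smooth if $h(y)\le h(x)+\langle\operatorname{grad}h(x),R_x^{-1}(y)\rangle_x+\frac{L}{2}\|R_x^{-1}(y)\|_x^2$ for all $x,y\in\mathcal{M}$ (for which $R_x^{-1}(y)$ is defined). Standing assumptions: $\mathcal{X}\subseteq\mathcal{M}$ is a compact (complete) $R$-convex set over which the retraction $R$ and its inverse $R^{-1}$ are well-defined and smooth, with $R_x^{-1}(y)$ continuous with respect to both $x$ and $y$; $f:\mathcal{M}\to\mathbb{R}$ is continuously differentiable; $g:\mathcal{M}\to\mathbb{R}$ is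 closed, $R$-convex and lower semicontinuous (possibly nonsmooth); $F:=f+g$. $\operatorname{diam}(\mathcal{X}):=\sup_{x,y\in\mathcal{X}}\operatorname{dist}(x,y)$. Riemannian generalized conditional gradient method: start from $x^0\in\mathcal{X}$. At iteration $k=0,1,2,\ldots$, let $p(x^k)\in\arg\min_{u\in\mathcal{X}}\{\langle\operatorname{grad}f(x^k),R^{-1}_{x^k}(u)\rangle_{x^k}+g(u)-g(x^k)\}$, let $\theta(x^k)$ be the optimal value of this minimization problem, put $d(x^k)=R^{-1}_{x^k}(p(x^k))$, choose a step size $\lambda_k$, and set $x^{k+1}=R_{x^k}(\lambda_kd(x^k))$. Armijo step size: fix $\zeta\in(0,1)$ and $0<\omega_1<\omega_2<1$. Start with the trial value $\lambda_{k_0}=1$, $\ell=0$. If $F(R_{x^k}(\lambda_{k_\ell}d(x^k)))\le F(x^k)+\zeta\lambda_{k_\ell}\theta(x^k)$, set $\lambda_k:=\lambda_{k_\ell}$ and stop; otherwise choose any $\lambda_{k_{\ell+1}}\in[\omega_1\lambda_{k_\ell},\omega_2\lambda_{k_\ell}]$, increase $\ell$ by one and repeat the test.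
   Formalization: Statement (2) is proved under the extra assumption that ‖d(x^k)‖ = ‖R^{-1}_{x^k}(p(x^k))‖ ≤ Ω for all k; with Ω bounding only R^{-1}_{x^i}(x^j) for iterates and diam(X), (2) fails (e.g. R_x(v) = x + tanh v on the real line). *)

theory Defs
  imports "HOL-Analysis.Analysis"
begin

section \<open>Smooth functions between vector spaces\<close>

text \<open>Only meant for an open set \<open>S\<close>: \<open>f\<close> is of class $C^k$ on \<open>S\<close>.\<close>

primrec Ck_on :: "nat \<Rightarrow> 'a::real_normed_vector set \<Rightarrow> ('a \<Rightarrow> 'b::real_normed_vector) \<Rightarrow> bool" where
  "Ck_on 0 S f \<longleftrightarrow> continuous_on S f"
| "Ck_on (Suc k) S f \<longleftrightarrow>
     (\<forall>x\<in>S. f differentiable (at x)) \<and> (\<forall>v. Ck_on k S (\<lambda>x. frechet_derivative f (at x) v))"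

definition smooth_on :: "'a::real_normed_vector set \<Rightarrow> ('a \<Rightarrow> 'b::real_normed_vector) \<Rightarrow> bool" where
  "smooth_on S f \<longleftrightarrow> (\<forall>k. Ck_on k S f)"


section \<open>Smooth manifolds\<close>

text \<open>The manifold is the whole type \<open>'m\<close> (Hausdorff and second countable by its sort), modelled on
  the Euclidean space \<open>'e\<close>. A chart is a pair of its domain and its coordinate map.\<close>

type_synonym ('m, 'e) chart = "'m set \<times> ('m \<Rightarrow> 'e)"

abbreviation cdom :: "('m, 'e) chart \<Rightarrow> 'm set" where
  "cdom c \<equiv> fst c"

abbreviation coord :: "('m, 'e) chart \<Rightarrow> 'm \<Rightarrow> 'e" where
  "coord c \<equiv> snd c"

definition cimg :: "('m, 'e) chart \<Rightarrow> 'e set" where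
  "cimg c = coord c ` cdom c"

definition point :: "('m, 'e) chart \<Rightarrow> 'e \<Rightarrow> 'm" where
  "point c = inv_into (cdom c) (coord c)"

definition is_chart :: "('m::topological_space, 'e::euclidean_space) chart \<Rightarrow> bool" where
  "is_chart c \<longleftrightarrow> open (cdom c) \<and> open (cimg c) \<and>
     homeomorphism (cdom c) (cimg c) (coord c) (point c)"

definition smooth_atlas ::
  "('m::{t2_space,second_countable_topology}, 'e::euclidean_space) chart set \<Rightarrow> bool" where
  "smooth_atlas A \<longleftrightarrow>
     (\<forall>c\<in>A. is_chart c) \<and> (\<Union>c\<in>A. cdom c) = UNIV \<and>
     (\<forall>c\<in>A. \<forall>d\<in>A. smooth_on (coord c ` (cdom c \<inter> cdom d)) (coord d \<circ> point c))"

text \<open>Every tangent space $T_x\mathcal M$ is represented by the model space \<open>'e\<close>: a tangent vector at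
  \<open>x\<close> is given by its components in one preferred chart around \<open>x\<close>. The choice of that chart need
  not depend continuously on \<open>x\<close>, so \<open>'m \<times> 'e\<close> with the product topology is not the tangent bundle.
  Anything concerning several base points at once is therefore expressed in the charts of
  the tangent bundle that an arbitrary chart \<open>c\<close> of the manifold induces: \<open>tcomp A c x\<close> sends
  $v\in T_x\mathcal M$ to its components in \<open>c\<close>, and \<open>tvec A c x\<close> is the inverse of that map.\<close>

definition chart_at :: "('m, 'e) chart set \<Rightarrow> 'm \<Rightarrow> ('m, 'e) chart" where
  "chart_at A x = (SOME c. c \<in> A \<and> x \<in> cdom c)"

definition tcomp ::
  "('m, 'e::euclidean_space) chart set \<Rightarrow> ('m, 'e) chart \<Rightarrow> 'm \<Rightarrow> 'e \<Rightarrow> 'e" where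
  "tcomp A c x v =
     frechet_derivative (coord c \<circ> point (chart_at A x)) (at (coord (chart_at A x) x)) v"

definition tvec ::
  "('m, 'e::euclidean_space) chart set \<Rightarrow> ('m, 'e) chart \<Rightarrow> 'm \<Rightarrow> 'e \<Rightarrow> 'e" where
  "tvec A c x a = frechet_derivative (coord (chart_at A x) \<circ> point c) (at (coord c x)) a"

definition Ck_fun ::
  "('m, 'e::euclidean_space) chart set \<Rightarrow> nat \<Rightarrow> ('m \<Rightarrow> real) \<Rightarrow> bool" where
  "Ck_fun A k f \<longleftrightarrow> (\<forall>c\<in>A. Ck_on k (cimg c) (f \<circ> point c))"

text \<open>Smoothness of a map from an open subset \<open>W\<close> of a vector space into the manifold.\<close>

definition smooth_into ::
  "('m::topological_space, 'e::euclidean_space) chart set \<Rightarrow>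
     'a::real_normed_vector set \<Rightarrow> ('a \<Rightarrow> 'm) \<Rightarrow> bool" where
  "smooth_into A W h \<longleftrightarrow> continuous_on W h \<and>
     (\<forall>d\<in>A. smooth_on (W \<inter> h -` cdom d) (coord d \<circ> h))"


section \<open>Riemannian metric, gradient and distance\<close>

definition riemannian_metric ::
  "('m, 'e::euclidean_space) chart set \<Rightarrow> ('m \<Rightarrow> 'e \<Rightarrow> 'e \<Rightarrow> real) \<Rightarrow> bool" where
  "riemannian_metric A G \<longleftrightarrow>
     (\<forall>x. bilinear (G x) \<and> (\<forall>v w. G x v w = G x w v) \<and> (\<forall>v. v \<noteq> 0 \<longrightarrow> 0 < G x v v)) \<and>
     (\<forall>c\<in>A. \<forall>a b. smooth_on (cimg c)
        (\<lambda>z. G (point c z) (tvec A c (point c z) a) (tvec A c (point c z) b)))"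

definition rnorm :: "('m \<Rightarrow> 'e \<Rightarrow> 'e \<Rightarrow> real) \<Rightarrow> 'm \<Rightarrow> 'e \<Rightarrow> real" where
  "rnorm G x v = sqrt (G x v v)"

definition differential ::
  "('m, 'e::euclidean_space) chart set \<Rightarrow> ('m \<Rightarrow> real) \<Rightarrow> 'm \<Rightarrow> 'e \<Rightarrow> real" where
  "differential A f x v =
     frechet_derivative (f \<circ> point (chart_at A x)) (at (coord (chart_at A x) x)) v"

definition rgrad ::
  "('m, 'e::euclidean_space) chart set \<Rightarrow> ('m \<Rightarrow> 'e \<Rightarrow> 'e \<Rightarrow> real) \<Rightarrow> ('m \<Rightarrow> real) \<Rightarrow> 'm \<Rightarrow> 'e" where
  "rgrad A G f x = (THE w. \<forall>v. G x w v = differential A f x v)"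

definition velocity ::
  "('m, 'e::euclidean_space) chart set \<Rightarrow> (real \<Rightarrow> 'm) \<Rightarrow> real \<Rightarrow> 'e" where
  "velocity A \<gamma> t = vector_derivative (coord (chart_at A (\<gamma> t)) \<circ> \<gamma>) (at t)"

text \<open>As for \<open>piecewise_C1_differentiable_on\<close>, no one-sided limits of the velocity are required
  at the exceptional points. Admitting these curves does not change the infimum of the lengths.\<close>

definition piecewise_C1_curve ::
  "('m::topological_space, 'e::euclidean_space) chart set \<Rightarrow> (real \<Rightarrow> 'm) \<Rightarrow> bool" where
  "piecewise_C1_curve A \<gamma> \<longleftrightarrow> continuous_on {0..1} \<gamma> \<and>
     (\<exists>S. finite S \<and>
        (\<forall>c\<in>A. (coord c \<circ> \<gamma>) C1_differentiable_on (({0<..<1} - S) \<inter> \<gamma> -` cdom c)))"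

definition curve_length ::
  "('m, 'e::euclidean_space) chart set \<Rightarrow> ('m \<Rightarrow> 'e \<Rightarrow> 'e \<Rightarrow> real) \<Rightarrow> (real \<Rightarrow> 'm) \<Rightarrow> ennreal" where
  "curve_length A G \<gamma> = (\<integral>\<^sup>+t\<in>{0..1}. ennreal (rnorm G (\<gamma> t) (velocity A \<gamma> t)) \<partial>lborel)"

text \<open>The distance is infinite between different components of the manifold.\<close>

definition rdist ::
  "('m::topological_space, 'e::euclidean_space) chart set \<Rightarrow> ('m \<Rightarrow> 'e \<Rightarrow> 'e \<Rightarrow> real) \<Rightarrow>
     'm \<Rightarrow> 'm \<Rightarrow> ennreal" where
  "rdist A G x y =
     (INF \<gamma> \<in> {\<gamma>. piecewise_C1_curve A \<gamma> \<and> \<gamma> 0 = x \<and> \<gamma> 1 = y}. curve_length A G \<gamma>)"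

definition rdiam ::
  "('m::topological_space, 'e::euclidean_space) chart set \<Rightarrow> ('m \<Rightarrow> 'e \<Rightarrow> 'e \<Rightarrow> real) \<Rightarrow>
     'm set \<Rightarrow> ennreal" where
  "rdiam A G X = (SUP (x, y) \<in> X \<times> X. rdist A G x y)"


section \<open>Retractions\<close>

definition manifold_retraction ::
  "('m::topological_space, 'e::euclidean_space) chart set \<Rightarrow> ('m \<Rightarrow> 'e \<Rightarrow> 'm) \<Rightarrow> bool" where
  "manifold_retraction A R \<longleftrightarrow>
     (\<forall>c\<in>A. smooth_into A (cimg c \<times> UNIV) (\<lambda>(z, a). R (point c z) (tvec A c (point c z) a))) \<and>
     (\<forall>x. R x 0 = x) \<and>
     (\<forall>x. ((coord (chart_at A x) \<circ> R x) has_derivative (\<lambda>v. v)) (at 0))"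

text \<open>A retraction need not be injective on a whole tangent space (take the exponential map of a
  sphere), so $R_x^{-1}$ denotes the inverse of the restriction of $R_x$ to a set \<open>U x\<close> that contains
  $0_x$ and on which $R_x$ is injective, and $R_x^{-1}(y)$ is well-defined iff \<open>y\<close> has a preimage in
  \<open>U x\<close>. Nothing else is required of \<open>U\<close>. If $R_x$ is injective, \<open>U x = UNIV\<close> is allowed; calling
  $R_x^{-1}(y)$ well-defined iff \<open>y\<close> has exactly one preimage in $T_x\mathcal M$ is covered too, by
  adding $0_x$ to the set of those unique preimages.\<close>

definition injectivity_domain :: "('m \<Rightarrow> 'e::zero \<Rightarrow> 'm) \<Rightarrow> ('m \<Rightarrow> 'e set) \<Rightarrow> bool" where
  "injectivity_domain R U \<longleftrightarrow> (\<forall>x. 0 \<in> U x \<and> inj_on (R x) (U x))"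

definition rinv_defined :: "('m \<Rightarrow> 'e \<Rightarrow> 'm) \<Rightarrow> ('m \<Rightarrow> 'e set) \<Rightarrow> 'm \<Rightarrow> 'm \<Rightarrow> bool" where
  "rinv_defined R U x y \<longleftrightarrow> y \<in> R x ` U x"

definition rinv :: "('m \<Rightarrow> 'e \<Rightarrow> 'm) \<Rightarrow> ('m \<Rightarrow> 'e set) \<Rightarrow> 'm \<Rightarrow> 'm \<Rightarrow> 'e" where
  "rinv R U x y = inv_into (U x) (R x) y"

text \<open>$R_x^{-1}(y)$ is well-defined and smooth in \<open>(x, y)\<close>, as a map into the tangent bundle, on a
  neighbourhood of $X\times X$. In particular it is continuous in both arguments.\<close>

definition rinv_smooth_over ::
  "('m::topological_space, 'e::euclidean_space) chart set \<Rightarrow> ('m \<Rightarrow> 'e \<Rightarrow> 'm) \<Rightarrow> ('m \<Rightarrow> 'e set) \<Rightarrow>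
     'm set \<Rightarrow> bool" where
  "rinv_smooth_over A R U X \<longleftrightarrow>
     (\<exists>W. open W \<and> X \<times> X \<subseteq> W \<and> (\<forall>(x, y)\<in>W. rinv_defined R U x y) \<and>
        (\<forall>c\<in>A. \<forall>d\<in>A. smooth_on
           {(z, w). z \<in> cimg c \<and> w \<in> cimg d \<and> (point c z, point d w) \<in> W}
           (\<lambda>(z, w). tcomp A c (point c z) (rinv R U (point c z) (point d w)))))"

definition R_convex_set ::
  "('m \<Rightarrow> 'e::real_vector \<Rightarrow> 'm) \<Rightarrow> ('m \<Rightarrow> 'e set) \<Rightarrow> 'm set \<Rightarrow> bool" where
  "R_convex_set R U S \<longleftrightarrow>
     (\<forall>x\<in>S. \<forall>y\<in>S. rinv_defined R U x y \<longrightarrow> (\<forall>t\<in>{0..1}. R x (t *\<^sub>R rinv R U x y) \<in> S))"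

definition R_convex_fun ::
  "('m \<Rightarrow> 'e::real_vector \<Rightarrow> 'm) \<Rightarrow> ('m \<Rightarrow> 'e set) \<Rightarrow> ('m \<Rightarrow> real) \<Rightarrow> bool" where
  "R_convex_fun R U h \<longleftrightarrow>
     (\<forall>x y. rinv_defined R U x y \<longrightarrow>
        (\<forall>t\<in>{0..1}. h (R x (t *\<^sub>R rinv R U x y)) \<le> (1 - t) * h x + t * h y))"

text \<open>Differentiability of \<open>h\<close> is not part of this definition; it has to be assumed along with it.\<close>

definition L_smooth ::
  "('m, 'e::euclidean_space) chart set \<Rightarrow> ('m \<Rightarrow> 'e \<Rightarrow> 'e \<Rightarrow> real) \<Rightarrow> ('m \<Rightarrow> 'e \<Rightarrow> 'm) \<Rightarrow>
     ('m \<Rightarrow> 'e set) \<Rightarrow> real \<Rightarrow> ('m \<Rightarrow> real) \<Rightarrow> bool" where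
  "L_smooth A G R U L h \<longleftrightarrow>
     (\<forall>x y. rinv_defined R U x y \<longrightarrow>
        h y \<le> h x + G x (rgrad A G h x) (rinv R U x y) + L / 2 * (rnorm G x (rinv R U x y))\<^sup>2)"

definition closed_fun :: "('m::topological_space \<Rightarrow> real) \<Rightarrow> bool" where
  "closed_fun h \<longleftrightarrow> closed {(x, t). h x \<le> t}"

definition lower_semicontinuous :: "('m::topological_space \<Rightarrow> real) \<Rightarrow> bool" where
  "lower_semicontinuous h \<longleftrightarrow> (\<forall>x. \<forall>a < h x. \<forall>\<^sub>F y in nhds x. a < h y)"


section \<open>The generalized conditional gradient method\<close>

definition rgcg_objective ::
  "('m, 'e::euclidean_space) chart set \<Rightarrow> ('m \<Rightarrow> 'e \<Rightarrow> 'e \<Rightarrow> real) \<Rightarrow> ('m \<Rightarrow> 'e \<Rightarrow> 'm) \<Rightarrow>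
     ('m \<Rightarrow> 'e set) \<Rightarrow> ('m \<Rightarrow> real) \<Rightarrow> ('m \<Rightarrow> real) \<Rightarrow> 'm \<Rightarrow> 'm \<Rightarrow> real" where
  "rgcg_objective A G R U f g x u = G x (rgrad A G f x) (rinv R U x u) + g u - g x"

definition rgcg_theta ::
  "('m, 'e::euclidean_space) chart set \<Rightarrow> ('m \<Rightarrow> 'e \<Rightarrow> 'e \<Rightarrow> real) \<Rightarrow> ('m \<Rightarrow> 'e \<Rightarrow> 'm) \<Rightarrow>
     ('m \<Rightarrow> 'e set) \<Rightarrow> ('m \<Rightarrow> real) \<Rightarrow> ('m \<Rightarrow> real) \<Rightarrow> 'm set \<Rightarrow> 'm \<Rightarrow> real" where
  "rgcg_theta A G R U f g X x = (INF u\<in>X. rgcg_objective A G R U f g x u)"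

text \<open>\<open>lam\<close> is a possible outcome of the backtracking procedure with trial values \<open>\<tau> 0, ..., \<tau> l\<close>,
  where \<open>\<phi> s\<close> is the function value after a step of size \<open>s\<close> and \<open>\<phi>0\<close> the current one.\<close>

definition armijo_step ::
  "real \<Rightarrow> real \<Rightarrow> real \<Rightarrow> (real \<Rightarrow> real) \<Rightarrow> real \<Rightarrow> real \<Rightarrow> real \<Rightarrow> bool" where
  "armijo_step \<zeta> \<omega>1 \<omega>2 \<phi> \<phi>0 \<theta> lam \<longleftrightarrow>
     (\<exists>l \<tau>. \<tau> (0::nat) = 1 \<and>
        (\<forall>j<l. \<not> \<phi> (\<tau> j) \<le> \<phi>0 + \<zeta> * \<tau> j * \<theta> \<and> \<tau> (Suc j) \<in> {\<omega>1 * \<tau> j .. \<omega>2 * \<tau> j}) \<and>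
        \<phi> (\<tau> l) \<le> \<phi>0 + \<zeta> * \<tau> l * \<theta> \<and> lam = \<tau> l)"

definition rgcg_armijo_sequence ::
  "('m, 'e::euclidean_space) chart set \<Rightarrow> ('m \<Rightarrow> 'e \<Rightarrow> 'e \<Rightarrow> real) \<Rightarrow> ('m \<Rightarrow> 'e \<Rightarrow> 'm) \<Rightarrow>
     ('m \<Rightarrow> 'e set) \<Rightarrow> ('m \<Rightarrow> real) \<Rightarrow> ('m \<Rightarrow> real) \<Rightarrow> 'm set \<Rightarrow> real \<Rightarrow> real \<Rightarrow> real \<Rightarrow>
     (nat \<Rightarrow> 'm) \<Rightarrow> (nat \<Rightarrow> 'm) \<Rightarrow> (nat \<Rightarrow> 'e) \<Rightarrow> (nat \<Rightarrow> real) \<Rightarrow> bool" where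
  "rgcg_armijo_sequence A G R U f g X \<zeta> \<omega>1 \<omega>2 x p d lam \<longleftrightarrow>
     x 0 \<in> X \<and>
     (\<forall>k. is_arg_min (rgcg_objective A G R U f g (x k)) (\<lambda>u. u \<in> X) (p k) \<and>
          d k = rinv R U (x k) (p k) \<and>
          armijo_step \<zeta> \<omega>1 \<omega>2
            (\<lambda>s. f (R (x k) (s *\<^sub>R d k)) + g (R (x k) (s *\<^sub>R d k))) (f (x k) + g (x k))
            (rgcg_theta A G R U f g X (x k)) (lam k) \<and>
          x (Suc k) = R (x k) (lam k *\<^sub>R d k))"

end

theory Submission
  imports Defs
begin

text \<open>Along the segment from \<open>x k\<close> towards \<open>p k\<close>, \<open>L\<close>-smoothness of \<open>f\<close> and convexity of \<open>g\<close> bound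
  \<open>F\<close> by a quadratic model with slope \<open>\<theta> (x k)\<close>. Hence every rejected Armijo trial value is at least
  a constant times \<open>\<bar>\<theta> (x k)\<bar>\<close>, and each step decreases \<open>F\<close> by at least
  \<open>\<zeta> * min \<bar>\<theta> (x k)\<bar> (c * (\<theta> (x k))\<^sup>2)\<close>. The decreases telescope, and \<open>F (x k)\<close> converges because it is
  monotone and converges along a subsequence of \<open>x\<close> that has a limit in \<open>X\<close>. The constant \<open>c\<close> of the qualitative
  statement comes from a bound of $R_x^{-1}(y)$ over $X\times X$, since \<open>\<Omega>\<close> bounds \<open>d k\<close> only by
  hypothesis.\<close>

section \<open>Preliminaries from real analysis and topology\<close>

lemma tendsto_zero_if_min_le:
  fixes t :: "nat \<Rightarrow> real"
  assumes "u \<longlonglongrightarrow> 0" "0 < c" "\<And>k. 0 \<le> t k" "\<And>k. min (t k) (c * (t k)\<^sup>2) \<le> u k"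
  shows "t \<longlonglongrightarrow> 0"
proof (rule LIMSEQ_I)
  fix r :: real assume r: "0 < r"
  \<comment> \<open>The minimum of \<open>t\<close> and \<open>c * t\<^sup>2\<close> increases with
    \<open>t \<ge> 0\<close>, so a value \<open>t k \<ge> r\<close> would keep \<open>u k\<close>
    above the threshold \<open>min r (c * r\<^sup>2)\<close>; this fails for large
    \<open>k\<close>.\<close>
  then have "0 < min r (c * r\<^sup>2)" using assms(2) by simp
  from order_tendstoD(2)[OF assms(1) this] obtain n where n: "\<And>k. n \<le> k \<Longrightarrow> u k < min r (c * r\<^sup>2)"
    by (auto simp: eventually_sequentially)
  have "norm (t k - 0) < r" if "n \<le> k" for k
  proof (rule ccontr)
    assume "\<not> norm (t k - 0) < r"
    then have "r \<le> t k" using assms(3)[of k] by auto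
    moreover from this have "c * r\<^sup>2 \<le> c * (t k)\<^sup>2"
      using r assms(2) by (intro mult_left_mono power_mono) auto
    ultimately show False using n[OF that] assms(4)[of k] by linarith
  qed
  then show "\<exists>n. \<forall>k\<ge>n. norm (t k - 0) < r" by blast
qed

lemma isCont_imp_tendsto_nhds: "isCont f x \<Longrightarrow> (f \<longlongrightarrow> f x) (nhds x)"
  by (simp add: isCont_def tendsto_at_iff_tendsto_nhds)

lemma isCont_eventually_less:
  fixes h :: "'a::t2_space \<Rightarrow> 'b::linorder_topology"
  shows "isCont h x \<Longrightarrow> h x < c \<Longrightarrow> \<forall>\<^sub>F y in nhds x. h y < c"
  using isCont_imp_tendsto_nhds order_tendstoD(2) by blast

text \<open>Finitely many of the local bounds cover \<open>S\<close>, so continuity of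
  \<open>h\<close> is not involved. This suits norms of tangent vectors at varying base points,
  which are only compared with chart expressions up to constants.\<close>

lemma compact_imp_bdd_above_image_if_locally:
  fixes h :: "'a::topological_space \<Rightarrow> real"
  assumes "compact S" "\<And>x. x \<in> S \<Longrightarrow> \<exists>B. \<forall>\<^sub>F y in nhds x. h y \<le> B"
  shows "bdd_above (h ` S)"
proof -
  have "\<forall>x\<in>S. \<exists>B T. open T \<and> x \<in> T \<and> (\<forall>y\<in>T. h y \<le> B)"
    using assms(2) unfolding eventually_nhds by blast
  then obtain B T where T: "\<And>x. x \<in> S \<Longrightarrow> open (T x) \<and> x \<in> T x \<and> (\<forall>y\<in>T x. h y \<le> B x)"
    by metis
  obtain D where D: "D \<subseteq> S" "finite D" "S \<subseteq> (\<Union>x\<in>D. T x)"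
    using compactE_image[OF assms(1), of S T] T by blast
  have "h y \<le> Max (B ` D)" if y: "y \<in> S" for y
  proof -
    obtain x where "x \<in> D" "y \<in> T x" using D y by blast
    with D T have "h y \<le> B x" by blast
    also have "\<dots> \<le> Max (B ` D)" using D \<open>x \<in> D\<close> by simp
    finally show ?thesis .
  qed
  then show ?thesis by (intro bdd_aboveI2)
qed

text \<open>The point is uniformity in \<open>a\<close>. A bilinear form is determined by its
  finitely many values on basis vectors, and the sum \<open>s\<close> of their deviations controls
  the quadratic form at every \<open>a\<close> simultaneously.\<close>

lemma bilinear_quadratic_perturb:
  fixes B :: "'m::t2_space \<Rightarrow> 'e::euclidean_space \<Rightarrow> 'e \<Rightarrow> real"
  assumes bil: "\<forall>\<^sub>F y in nhds x. bilinear (B y)"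
    and cont: "\<And>a b. isCont (\<lambda>y. B y a b) x" and "0 < e"
  shows "\<forall>\<^sub>F y in nhds x. \<forall>a. \<bar>B y a a - B x a a\<bar> \<le> e * (norm a)\<^sup>2"
proof -
  define s where "s y = (\<Sum>i\<in>Basis. \<Sum>j\<in>Basis. \<bar>B y i j - B x i j\<bar>)" for y
  have "isCont s x" unfolding s_def by (intro continuous_intros cont)
  moreover have "s x = 0" by (simp add: s_def)
  ultimately have "\<forall>\<^sub>F y in nhds x. s y < e" using \<open>0 < e\<close> by (intro isCont_eventually_less) auto
  then show ?thesis using bil
  proof eventually_elim
    case (elim y)
    have bx: "bilinear (B x)" using bil by (rule eventually_nhds_x_imp_x)
    have expand: "B z a a = (\<Sum>i\<in>Basis. \<Sum>j\<in>Basis. (a \<bullet> i) * (a \<bullet> j) * B z i j)"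
      if "bilinear (B z)" for z a
    proof -
      have "B z a a = B z (\<Sum>i\<in>Basis. (a \<bullet> i) *\<^sub>R i) (\<Sum>i\<in>Basis. (a \<bullet> i) *\<^sub>R i)"
        by (simp add: euclidean_representation)
      also have "\<dots> = (\<Sum>(i, j)\<in>Basis \<times> Basis. B z ((a \<bullet> i) *\<^sub>R i) ((a \<bullet> j) *\<^sub>R j))"
        by (rule bilinear_sum[OF that])
      also have "\<dots> = (\<Sum>i\<in>Basis. \<Sum>j\<in>Basis. (a \<bullet> i) * (a \<bullet> j) * B z i j)"
        by (simp add: sum.cartesian_product bilinear_lmul[OF that] bilinear_rmul[OF that] mult_ac)
      finally show ?thesis .
    qed
    have "\<bar>B y a a - B x a a\<bar> \<le> e * (norm a)\<^sup>2" for a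
    proof -
      have "B y a a - B x a a = (\<Sum>i\<in>Basis. \<Sum>j\<in>Basis. (a \<bullet> i) * (a \<bullet> j) * (B y i j - B x i j))"
        unfolding expand[OF elim(2)] expand[OF bx]
        by (simp add: sum_subtractf[symmetric] right_diff_distrib)
      also have "\<bar>\<dots>\<bar> \<le> (\<Sum>i\<in>Basis. \<Sum>j\<in>Basis. \<bar>(a \<bullet> i) * (a \<bullet> j) * (B y i j - B x i j)\<bar>)"
        by (intro order_trans[OF sum_abs] sum_mono) auto
      also have "\<dots> \<le> (\<Sum>i\<in>Basis. \<Sum>j\<in>Basis. (norm a)\<^sup>2 * \<bar>B y i j - B x i j\<bar>)"
        unfolding abs_mult power2_eq_square
        by (intro sum_mono mult_right_mono mult_mono Basis_le_norm) auto
      also have "\<dots> = (norm a)\<^sup>2 * s y" by (simp add: s_def sum_distrib_left)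
      also have "\<dots> \<le> (norm a)\<^sup>2 * e" using elim(1) by (intro mult_left_mono) auto
      finally show ?thesis by (simp add: mult.commute)
    qed
    then show ?case by blast
  qed
qed

section \<open>Charts, tangent vectors and the Riemannian metric\<close>

locale riemannian =
  fixes A :: "('m::{t2_space,second_countable_topology}, 'e::euclidean_space) chart set"
    and G :: "'m \<Rightarrow> 'e \<Rightarrow> 'e \<Rightarrow> real"
  assumes atlas: "smooth_atlas A" and metric: "riemannian_metric A G"
begin

lemma chart_at: "chart_at A x \<in> A" "x \<in> cdom (chart_at A x)"
proof -
  have "x \<in> (\<Union>c\<in>A. cdom c)" using atlas by (simp add: smooth_atlas_def)
  then have "\<exists>c. c \<in> A \<and> x \<in> cdom c" by blast
  from someI_ex[OF this] show "chart_at A x \<in> A" "x \<in> cdom (chart_at A x)"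
    by (auto simp: chart_at_def)
qed

lemma
  assumes "c \<in> A"
  shows open_cdom: "open (cdom c)" and open_cimg: "open (cimg c)"
    and chart_homeomorphism: "homeomorphism (cdom c) (cimg c) (coord c) (point c)"
  using assms atlas by (auto simp: smooth_atlas_def is_chart_def)

lemma
  assumes "c \<in> A"
  shows continuous_on_coord: "continuous_on (cdom c) (coord c)"
    and continuous_on_point: "continuous_on (cimg c) (point c)"
    and point_coord: "x \<in> cdom c \<Longrightarrow> point c (coord c x) = x"
    and coord_point: "z \<in> cimg c \<Longrightarrow> coord c (point c z) = z"
    and coord_in: "x \<in> cdom c \<Longrightarrow> coord c x \<in> cimg c"
  using chart_homeomorphism[OF assms] by (auto simp: homeomorphism_def)

lemma open_coord_image:
  assumes "c \<in> A" "open S"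
  shows "open (coord c ` (cdom c \<inter> S))"
proof -
  have "openin (top_of_set (cimg c)) (coord c ` (cdom c \<inter> S))"
    using homeomorphism_imp_open_map[OF chart_homeomorphism[OF assms(1)]] assms(2)
    by (simp add: openin_open_Int)
  then show ?thesis using open_cimg[OF assms(1)] openin_open_eq by blast
qed

lemma continuous_on_cdom:
  assumes "c \<in> A" "continuous_on (cimg c) (h \<circ> point c)"
  shows "continuous_on (cdom c) h"
proof -
  have "continuous_on (cdom c) ((h \<circ> point c) \<circ> coord c)"
    using continuous_on_compose[OF continuous_on_coord[OF assms(1)] assms(2)[unfolded cimg_def]] .
  then show ?thesis by (rule continuous_on_eq) (simp add: point_coord[OF assms(1)])
qed

lemma transition_differentiable:
  assumes "c \<in> A" "d \<in> A" "x \<in> cdom c" "x \<in> cdom d"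
  shows "(coord d \<circ> point c) differentiable (at (coord c x))"
proof -
  have "smooth_on (coord c ` (cdom c \<inter> cdom d)) (coord d \<circ> point c)"
    using atlas assms(1,2) by (simp add: smooth_atlas_def)
  then have "Ck_on (Suc 0) (coord c ` (cdom c \<inter> cdom d)) (coord d \<circ> point c)"
    unfolding smooth_on_def by blast
  then show ?thesis using assms by simp
qed

text \<open>Chain rule for \<open>(k \<circ> point d) \<circ> (coord d \<circ> point c)\<close>.
  This composite agrees with \<open>k \<circ> point c\<close> only on the coordinate image of the
  overlap of the two domains, which is open, so the derivatives coincide.\<close>

lemma change_of_chart_derivative:
  assumes "c \<in> A" "d \<in> A" "x \<in> cdom c" "x \<in> cdom d"
    and "(k \<circ> point d) differentiable (at (coord d x))"
  shows "((k \<circ> point c) has_derivative (\<lambda>v. frechet_derivative (k \<circ> point d) (at (coord d x))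
           (frechet_derivative (coord d \<circ> point c) (at (coord c x)) v))) (at (coord c x))"
proof -
  let ?D = "frechet_derivative (k \<circ> point d) (at (coord d x))"
  let ?T = "frechet_derivative (coord d \<circ> point c) (at (coord c x))"
  have "((coord d \<circ> point c) has_derivative ?T) (at (coord c x))"
    using transition_differentiable[OF assms(1-4)] frechet_derivative_works by blast
  moreover have "((k \<circ> point d) has_derivative ?D) (at ((coord d \<circ> point c) (coord c x)))"
    using assms(5) unfolding o_apply point_coord[OF assms(1,3)] by (rule frechet_derivative_works[THEN iffD1])
  ultimately have "((k \<circ> point d) \<circ> (coord d \<circ> point c) has_derivative (?D \<circ> ?T)) (at (coord c x))"
    by (rule diff_chain_at)
  then have "((k \<circ> point c) has_derivative (?D \<circ> ?T)) (at (coord c x))"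
  proof (rule has_derivative_transform_within_open)
    show "open (coord c ` (cdom c \<inter> cdom d))"
      using open_coord_image assms open_cdom by blast
  qed (use assms in \<open>auto simp: point_coord\<close>)
  then show ?thesis by (simp add: o_def)
qed

lemma linear_tvec:
  assumes "c \<in> A" "x \<in> cdom c" shows "linear (tvec A c x)"
  using transition_differentiable[OF assms(1) chart_at(1) assms(2) chart_at(2)]
  unfolding tvec_def by (auto intro: linear_frechet_derivative)

lemma linear_tcomp:
  assumes "c \<in> A" "x \<in> cdom c" shows "linear (tcomp A c x)"
  using transition_differentiable[OF chart_at(1) assms(1) chart_at(2) assms(2)]
  unfolding tcomp_def by (auto intro: linear_frechet_derivative)

text \<open>By the chain rule the composite is the derivative of
  \<open>coord b \<circ> point b\<close> for the preferred chart \<open>b\<close> at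
  \<open>x\<close>, and that map is the identity near \<open>coord b x\<close>.\<close>

lemma tvec_tcomp:
  assumes "c \<in> A" "x \<in> cdom c" shows "tvec A c x (tcomp A c x v) = v"
proof -
  let ?b = "chart_at A x"
  note b = chart_at[of x]
  have D: "((coord ?b \<circ> point ?b) has_derivative (\<lambda>v. tvec A c x (tcomp A c x v))) (at (coord ?b x))"
    unfolding tvec_def tcomp_def using b assms
    by (intro change_of_chart_derivative transition_differentiable)
  have "((\<lambda>z. z) has_derivative (\<lambda>v. tvec A c x (tcomp A c x v))) (at (coord ?b x))"
    by (rule has_derivative_transform_within_open[OF D open_cimg])
       (use b in \<open>auto simp: coord_point coord_in\<close>)
  from has_derivative_unique[OF this has_derivative_ident] show ?thesis by metis
qed

text \<open>In finite dimension a one-sided inverse of a linear endomorphism is two-sided.\<close>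

lemma tcomp_tvec:
  assumes "c \<in> A" "x \<in> cdom c" shows "tcomp A c x (tvec A c x a) = a"
proof -
  have "surj (tvec A c x)" using tvec_tcomp[OF assms] by (metis surjI)
  then have "inj (tvec A c x)" using linear_surjective_imp_injective linear_tvec[OF assms] by blast
  then show ?thesis using tvec_tcomp[OF assms] by (metis injD)
qed

text \<open>Moves the differential from the preferred chart, which may jump from point to point, to
  a chart that can be kept fixed on a whole neighbourhood.\<close>

lemma differential_eq:
  assumes "c \<in> A" "x \<in> cdom c" "(f \<circ> point c) differentiable (at (coord c x))"
  shows "differential A f x v = frechet_derivative (f \<circ> point c) (at (coord c x)) (tcomp A c x v)"
proof -
  have "((f \<circ> point (chart_at A x)) has_derivative
      (\<lambda>v. frechet_derivative (f \<circ> point c) (at (coord c x)) (tcomp A c x v))) (at (coord (chart_at A x) x))"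
    unfolding tcomp_def using chart_at assms by (intro change_of_chart_derivative)
  from frechet_derivative_at[OF this] show ?thesis unfolding differential_def by metis
qed

lemma
  shows bilinear_metric: "bilinear (G x)" and metric_sym: "G x v w = G x w v"
    and metric_pos: "v \<noteq> 0 \<Longrightarrow> 0 < G x v v"
  using metric by (auto simp: riemannian_metric_def)

lemma metric_nonneg: "0 \<le> G x v v"
  using metric_pos[of v x] bilinear_lzero[OF bilinear_metric, of x v] by (cases "v = 0") auto

lemma rnorm_nonneg: "0 \<le> rnorm G x v" by (simp add: rnorm_def metric_nonneg)

lemma rnorm_sq: "(rnorm G x v)\<^sup>2 = G x v v" by (simp add: rnorm_def metric_nonneg)

lemma rnorm_zero [simp]: "rnorm G x 0 = 0"
  by (simp add: rnorm_def bilinear_lzero[OF bilinear_metric])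

lemma metric_Cauchy_Schwarz: "\<bar>G x v w\<bar> \<le> rnorm G x v * rnorm G x w"
proof (cases "w = 0")
  case True then show ?thesis by (simp add: bilinear_rzero[OF bilinear_metric])
next
  case False
  note bil = bilinear_lsub[OF bilinear_metric] bilinear_rsub[OF bilinear_metric]
    bilinear_lmul[OF bilinear_metric] bilinear_rmul[OF bilinear_metric]
  define a where "a = G x v w"
  define b where "b = G x w w"
  have b: "0 < b" using metric_pos False by (simp add: b_def)
  \<comment> \<open>This is the usual vector \<open>v - (a / b) *\<^sub>R w\<close>, scaled by
    \<open>b\<close> to avoid division.\<close>
  have "0 \<le> G x (b *\<^sub>R v - a *\<^sub>R w) (b *\<^sub>R v - a *\<^sub>R w)" by (rule metric_nonneg)
  also have "\<dots> = b * (b * G x v v - a * a) - a * (b * G x w v - a * b)"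
    unfolding bil a_def b_def by (simp add: right_diff_distrib)
  also have "\<dots> = b * (G x v v * b - a\<^sup>2)"
    unfolding metric_sym[of x w v] a_def[symmetric] by (simp add: algebra_simps power2_eq_square)
  finally have "a\<^sup>2 \<le> G x v v * b" using b by (simp add: zero_le_mult_iff)
  also have "\<dots> = (rnorm G x v * rnorm G x w)\<^sup>2" by (simp add: power_mult_distrib rnorm_sq b_def)
  finally show ?thesis
    unfolding a_def by (metis abs_le_square_iff abs_of_nonneg mult_nonneg_nonneg rnorm_nonneg)
qed

text \<open>Continuity in the base point makes sense only for vectors with constant components in a
  fixed chart; for a constant element of the model space the preferred chart could jump.\<close>

lemma metric_coord_isCont:
  assumes "c \<in> A" "x \<in> cdom c"
  shows "isCont (\<lambda>y. G y (tvec A c y a) (tvec A c y b)) x"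
proof -
  have "smooth_on (cimg c) (\<lambda>z. G (point c z) (tvec A c (point c z) a) (tvec A c (point c z) b))"
    using metric assms by (simp add: riemannian_metric_def)
  then have "Ck_on 0 (cimg c) (\<lambda>z. G (point c z) (tvec A c (point c z) a) (tvec A c (point c z) b))"
    unfolding smooth_on_def by blast
  then have "continuous_on (cdom c) (\<lambda>y. G y (tvec A c y a) (tvec A c y b))"
    by (intro continuous_on_cdom[OF assms(1)]) (simp add: o_def)
  then show ?thesis using open_cdom assms continuous_on_eq_continuous_at by blast
qed

lemma bilinear_metric_coord:
  assumes "c \<in> A" "x \<in> cdom c"
  shows "bilinear (\<lambda>a b. G x (tvec A c x a) (tvec A c x b))"
  using bilinear_metric[of x] linear_compose[OF linear_tvec[OF assms], unfolded o_def]
  unfolding bilinear_def by blast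

text \<open>At \<open>x\<close> itself, positive definiteness and compactness of the unit sphere
  give a lower constant, and boundedness of bilinear forms gives an upper one.
  \<open>bilinear_quadratic_perturb\<close> carries both to nearby base points.\<close>

lemma rnorm_locally_equivalent:
  assumes c: "c \<in> A" "x \<in> cdom c"
  obtains m M where "0 < m" "0 < M"
    "\<forall>\<^sub>F y in nhds x. \<forall>v. m * norm (tcomp A c y v) \<le> rnorm G y v \<and> rnorm G y v \<le> M * norm (tcomp A c y v)"
proof -
  define B where "B y a b = G y (tvec A c y a) (tvec A c y b)" for y a b
  have near: "\<forall>\<^sub>F y in nhds x. y \<in> cdom c"
    using c open_cdom by (intro eventually_nhds_in_open)
  have bil: "bilinear (B y)" if "y \<in> cdom c" for y
    using bilinear_metric_coord[OF c(1) that] by (simp add: B_def[abs_def])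
  have bil': "\<forall>\<^sub>F y in nhds x. bilinear (B y)" using near by eventually_elim (rule bil)
  obtain K where K: "0 < K" "\<And>a b. norm (B x a b) \<le> K * norm a * norm b"
    using bilinear_bounded_pos[OF bil[OF c(2)]] by blast
  have inj: "tvec A c x a \<noteq> 0" if "a \<noteq> 0" for a
    using tcomp_tvec[OF c, of a] that linear_0[OF linear_tcomp[OF c]] by metis
  have "continuous_on (sphere 0 1) (\<lambda>a. B x a a)"
    by (rule bilinear_continuous_on_compose[OF continuous_on_id continuous_on_id bil[OF c(2)]])
  then obtain a0 where a0: "norm a0 = 1" "\<And>a. norm a = 1 \<Longrightarrow> B x a0 a0 \<le> B x a a"
    using continuous_attains_inf[OF compact_sphere, of "0::'e" 1 "\<lambda>a. B x a a"] by auto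
  define m where "m = B x a0 a0"
  have m: "0 < m" using a0(1) unfolding m_def B_def by (intro metric_pos inj) auto
  have lower: "m * (norm a)\<^sup>2 \<le> B x a a" for a
  proof (cases "a = 0")
    case True then show ?thesis by (simp add: bilinear_lzero[OF bil[OF c(2)]])
  next
    case False
    have "m \<le> B x (inverse (norm a) *\<^sub>R a) (inverse (norm a) *\<^sub>R a)"
      unfolding m_def using False by (intro a0(2)) simp
    also have "\<dots> = inverse (norm a) * (inverse (norm a) * B x a a)"
      by (simp add: bilinear_lmul[OF bil[OF c(2)]] bilinear_rmul[OF bil[OF c(2)]])
    finally show ?thesis using False by (simp add: field_simps power2_eq_square)
  qed
  \<comment> \<open>With tolerance \<open>m / 2\<close>, half of the lower constant \<open>m\<close>
    survives and the upper constant becomes \<open>K + m / 2\<close>; the square roots come from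
    passing to \<open>rnorm\<close>.\<close>
  have ev: "\<forall>\<^sub>F y in nhds x. \<forall>a. \<bar>B y a a - B x a a\<bar> \<le> m / 2 * (norm a)\<^sup>2"
    using m metric_coord_isCont[OF c] by (intro bilinear_quadratic_perturb bil') (auto simp: B_def)
  show thesis
  proof (rule that[of "sqrt (m / 2)" "sqrt (K + m / 2)"])
    show "\<forall>\<^sub>F y in nhds x. \<forall>v. sqrt (m / 2) * norm (tcomp A c y v) \<le> rnorm G y v \<and>
        rnorm G y v \<le> sqrt (K + m / 2) * norm (tcomp A c y v)"
      using ev near
    proof eventually_elim
      case (elim y)
      show ?case
      proof
        fix v
        define a where "a = tcomp A c y v"
        have near: "\<bar>B y a a - B x a a\<bar> \<le> m / 2 * (norm a)\<^sup>2" using elim(1) by blast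
        have "B y a a = G y v v" by (simp add: B_def a_def tvec_tcomp[OF c(1) elim(2)])
        moreover have "m / 2 * (norm a)\<^sup>2 \<le> B y a a"
          using abs_le_D2[OF near] lower[of a] by simp
        moreover have "B x a a \<le> K * (norm a)\<^sup>2"
          using K(2)[of a a] by (simp add: power2_eq_square mult.assoc)
        then have "B y a a \<le> (K + m / 2) * (norm a)\<^sup>2"
          using near unfolding distrib_right by linarith
        ultimately have "sqrt (m / 2 * (norm a)\<^sup>2) \<le> rnorm G y v" "rnorm G y v \<le> sqrt ((K + m / 2) * (norm a)\<^sup>2)"
          by (auto simp: rnorm_def)
        then show "sqrt (m / 2) * norm (tcomp A c y v) \<le> rnorm G y v \<and>
            rnorm G y v \<le> sqrt (K + m / 2) * norm (tcomp A c y v)"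
          unfolding real_sqrt_mult a_def by simp
      qed
    qed
  qed (use m K in auto)
qed

text \<open>This justifies the definite description in \<open>rgrad\<close>. The map
  \<open>T\<close> collects the values of \<open>G x w\<close> on the basis; positive definiteness
  makes it injective, hence surjective by dimension.\<close>

lemma riesz_representation:
  assumes "linear \<phi>"
  shows "\<exists>!w. \<forall>v. G x w v = \<phi> v"
proof -
  define T where "T w = (\<Sum>i\<in>Basis. G x w i *\<^sub>R i)" for w
  note bil = bilinear_metric[of x]
  have lin: "linear (G x w)" for w using bil by (simp add: bilinear_def)
  have T: "linear T"
    unfolding T_def by (rule linearI)
      (simp_all add: bilinear_ladd[OF bil] bilinear_lmul[OF bil] scaleR_add_left sum.distrib scaleR_sum_right)
  have Ti: "T w \<bullet> i = G x w i" if "i \<in> Basis" for w i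
    using that by (simp add: T_def)
  have "w = 0" if "T w = 0" for w
  proof -
    have "G x w i = 0" if "i \<in> Basis" for i using Ti[OF that, of w] \<open>T w = 0\<close> by simp
    then have "G x w = (\<lambda>v. 0)" by (rule linear_eq_stdbasis[OF lin linear_zero])
    then have "G x w w = 0" by simp
    then show "w = 0" using metric_pos[of w x] by (cases "w = 0") auto
  qed
  then have inj: "inj T" using T linear_injective_0 by blast
  then have "surj T" using T linear_injective_imp_surjective by blast
  then obtain w where w: "T w = (\<Sum>i\<in>Basis. \<phi> i *\<^sub>R i)" by (metis surjD)
  have "G x w i = \<phi> i" if "i \<in> Basis" for i
    using Ti[OF that, of w] that by (simp add: w)
  then have "G x w = \<phi>" using linear_eq_stdbasis[OF lin assms] by blast
  moreover have "w' = w" if "\<forall>v. G x w' v = \<phi> v" for w'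
    using that \<open>G x w = \<phi>\<close> inj by (auto simp: T_def inj_def)
  ultimately show ?thesis by auto
qed

section \<open>The gradient of a continuously differentiable function\<close>

context
  fixes f :: "'m \<Rightarrow> real"
  assumes C1: "Ck_fun A 1 f"
begin

lemma C1_differentiable:
  assumes "c \<in> A" "x \<in> cdom c"
  shows "(f \<circ> point c) differentiable (at (coord c x))"
  using C1 assms coord_in[OF assms] by (auto simp: Ck_fun_def)

lemma C1_isCont: "isCont f x"
proof -
  let ?c = "chart_at A x"
  have "continuous_on (cimg ?c) (f \<circ> point ?c)"
  proof (rule differentiable_imp_continuous_on)
    show "(f \<circ> point ?c) differentiable_on cimg ?c"
      using C1 chart_at(1) by (auto simp: Ck_fun_def differentiable_on_def intro: differentiable_at_withinI)
  qed
  then have "continuous_on (cdom ?c) f" using chart_at continuous_on_cdom by blast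
  then show ?thesis using open_cdom chart_at continuous_on_eq_continuous_at by blast
qed

lemma rgrad_eq: "G x (rgrad A G f x) v = differential A f x v"
proof -
  have "linear (differential A f x)"
    unfolding differential_def
    using linear_frechet_derivative[OF C1_differentiable[OF chart_at]] by (simp add: eta_contract_eq)
  from theI'[OF riesz_representation[OF this]] show ?thesis unfolding rgrad_def by blast
qed

text \<open>Pairing the gradient \<open>w\<close> with itself turns
  \<open>(rnorm G y w)\<^sup>2\<close> into the differential at \<open>w\<close>. In a fixed chart
  this is at most a locally bounded factor times the norm of the components of \<open>w\<close>,
  hence times \<open>rnorm G y w\<close>, and one factor \<open>rnorm G y w\<close> cancels.\<close>

lemma rnorm_rgrad_locally_bounded: "\<exists>B. \<forall>\<^sub>F y in nhds x. rnorm G y (rgrad A G f y) \<le> B"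
proof -
  let ?c = "chart_at A x"
  let ?D = "\<lambda>y. frechet_derivative (f \<circ> point ?c) (at (coord ?c y))"
  note c = chart_at[of x]
  obtain m M where m: "0 < m" and
    ev: "\<forall>\<^sub>F y in nhds x. \<forall>v. m * norm (tcomp A ?c y v) \<le> rnorm G y v \<and> rnorm G y v \<le> M * norm (tcomp A ?c y v)"
    using rnorm_locally_equivalent[OF c] by blast
  define s where "s y = (\<Sum>i\<in>Basis. \<bar>?D y i\<bar>)" for y
  have "isCont (\<lambda>y. ?D y i) x" for i
  proof -
    have "continuous_on (cimg ?c) (\<lambda>z. frechet_derivative (f \<circ> point ?c) (at z) i)"
      using C1 c by (auto simp: Ck_fun_def)
    then have "continuous_on (cdom ?c) (\<lambda>y. ?D y i)"
      using continuous_on_compose[OF continuous_on_coord[OF c(1)]] by (simp add: cimg_def o_def)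
    then show ?thesis using open_cdom c continuous_on_eq_continuous_at by blast
  qed
  then have "isCont s x" unfolding s_def by (intro continuous_intros)
  then have s: "\<forall>\<^sub>F y in nhds x. s y < s x + 1" by (rule isCont_eventually_less) simp
  have near: "\<forall>\<^sub>F y in nhds x. y \<in> cdom ?c" using c open_cdom by (intro eventually_nhds_in_open)
  from ev s near have "\<forall>\<^sub>F y in nhds x. rnorm G y (rgrad A G f y) \<le> (s x + 1) / m"
  proof eventually_elim
    case (elim y)
    define w where "w = rgrad A G f y"
    define a where "a = tcomp A ?c y w"
    have lin: "linear (?D y)" using linear_frechet_derivative C1_differentiable c elim(3) by blast
    have "?D y a = ?D y (\<Sum>i\<in>Basis. (a \<bullet> i) *\<^sub>R i)" by (simp add: euclidean_representation)
    also have "\<dots> = (\<Sum>i\<in>Basis. (a \<bullet> i) * ?D y i)"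
      using lin by (simp add: linear_sum linear_cmul)
    also have "\<dots> \<le> (\<Sum>i\<in>Basis. \<bar>(a \<bullet> i) * ?D y i\<bar>)" by (intro sum_mono) auto
    also have "\<dots> \<le> (\<Sum>i\<in>Basis. norm a * \<bar>?D y i\<bar>)"
      unfolding abs_mult by (intro sum_mono mult_right_mono Basis_le_norm) auto
    also have "\<dots> = norm a * s y" by (simp add: s_def sum_distrib_left)
    also have "\<dots> \<le> norm a * (s x + 1)" using elim(2) by (intro mult_left_mono) auto
    also have "\<dots> \<le> (rnorm G y w / m) * (s x + 1)"
    proof (rule mult_right_mono)
      show "norm a \<le> rnorm G y w / m"
        using elim(1) m by (simp add: a_def field_simps)
      show "0 \<le> s x + 1" by (auto simp: s_def intro!: add_nonneg_nonneg sum_nonneg)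
    qed
    finally have "(rnorm G y w)\<^sup>2 \<le> rnorm G y w * ((s x + 1) / m)"
      using rgrad_eq[of y w] differential_eq[OF c(1) elim(3) C1_differentiable[OF c(1) elim(3)], of w]
      by (simp add: rnorm_sq w_def a_def mult.commute)
    moreover have "0 \<le> (s x + 1) / m" using m by (auto simp: s_def intro!: divide_nonneg_pos add_nonneg_nonneg sum_nonneg)
    ultimately have "rnorm G y w \<le> (s x + 1) / m"
      using rnorm_nonneg[of y w] unfolding power2_eq_square
      by (cases "rnorm G y w = 0") (auto intro: mult_left_le_imp_le[of "rnorm G y w"] simp del: times_divide_eq_right)
    then show ?case by (simp add: w_def)
  qed
  then show ?thesis by blast
qed

end

end


section \<open>The retraction and its inverse near \<open>X \<times> X\<close>\<close>

locale retraction_over = riemannian A G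
  for A :: "('m::{t2_space,second_countable_topology}, 'e::euclidean_space) chart set" and G +
  fixes R :: "'m \<Rightarrow> 'e \<Rightarrow> 'm" and U :: "'m \<Rightarrow> 'e set" and X :: "'m set" and W :: "('m \<times> 'm) set"
  assumes retraction: "manifold_retraction A R" and injectivity: "injectivity_domain R U"
    and convex: "R_convex_set R U X"
    and open_W: "open W" and X_subset_W: "X \<times> X \<subseteq> W"
    and W_defined: "\<And>x y. (x, y) \<in> W \<Longrightarrow> rinv_defined R U x y"
    and W_smooth: "\<And>c d. c \<in> A \<Longrightarrow> d \<in> A \<Longrightarrow> smooth_on
           {(z, w). z \<in> cimg c \<and> w \<in> cimg d \<and> (point c z, point d w) \<in> W}
           (\<lambda>(z, w). tcomp A c (point c z) (rinv R U (point c z) (point d w)))"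
begin

lemma R_rinv: "(x, y) \<in> W \<Longrightarrow> R x (rinv R U x y) = y"
  using W_defined[of x y] unfolding rinv_defined_def rinv_def by (rule f_inv_into_f)

lemma rinv_R: "v \<in> U x \<Longrightarrow> rinv R U x (R x v) = v"
  using injectivity unfolding injectivity_domain_def rinv_def by (simp add: inv_into_f_f)

lemma rinv_self: "rinv R U x x = 0"
  using rinv_R[of 0 x] injectivity retraction
  by (simp add: injectivity_domain_def manifold_retraction_def)

lemma R_step_in:
  assumes "x \<in> X" "u \<in> X" "s \<in> {0..1}"
  shows "R x (s *\<^sub>R rinv R U x u) \<in> X"
  using convex assms W_defined X_subset_W unfolding R_convex_set_def by blast

lemma tcomp_rinv_isCont:
  assumes "c \<in> A" "x \<in> cdom c" "(x, y) \<in> W"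
  shows "isCont (\<lambda>(x, y). tcomp A c x (rinv R U x y)) (x, y)"
proof -
  let ?d = "chart_at A y"
  let ?S = "W \<inter> cdom c \<times> cdom ?d"
  let ?T = "{(z, w). z \<in> cimg c \<and> w \<in> cimg ?d \<and> (point c z, point ?d w) \<in> W}"
  let ?h = "\<lambda>(z, w). tcomp A c (point c z) (rinv R U (point c z) (point ?d w))"
  let ?k = "\<lambda>p. (coord c (fst p), coord ?d (snd p))"
  note d = chart_at[of y]
  have "Ck_on 0 ?T ?h"
    using W_smooth[OF assms(1) d(1)] unfolding smooth_on_def by blast
  then have h: "continuous_on ?T ?h" by simp
  have k: "continuous_on ?S ?k"
    by (intro continuous_on_Pair continuous_on_compose2[OF continuous_on_coord[OF assms(1)]]
        continuous_on_compose2[OF continuous_on_coord[OF d(1)]] continuous_intros) auto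
  have "continuous_on ?S (\<lambda>p. ?h (?k p))"
    by (rule continuous_on_compose2[OF h k])
       (auto simp: coord_in[OF assms(1)] coord_in[OF d(1)] point_coord[OF assms(1)] point_coord[OF d(1)])
  then have "continuous_on ?S (\<lambda>(x, y). tcomp A c x (rinv R U x y))"
    by (rule continuous_on_eq) (auto simp: point_coord[OF assms(1)] point_coord[OF d(1)])
  moreover have "open ?S" "(x, y) \<in> ?S"
    using open_W open_cdom[OF assms(1)] open_cdom[OF d(1)] assms d by (auto intro: open_Int open_Times)
  ultimately show ?thesis using continuous_on_eq_continuous_at by blast
qed

text \<open>Once the base point is fixed, so is its preferred chart, and continuity passes from the
  components to the tangent vector itself.\<close>

lemma rinv_isCont:
  assumes "(x, y) \<in> W"
  shows "isCont (rinv R U x) y"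
proof -
  let ?c = "chart_at A x"
  have "isCont (\<lambda>y. (x, y)) y" by (intro continuous_intros)
  from isCont_o2[OF this tcomp_rinv_isCont[OF chart_at assms]]
  have "isCont (\<lambda>y. tcomp A ?c x (rinv R U x y)) y" by simp
  then have "isCont (\<lambda>y. tvec A ?c x (tcomp A ?c x (rinv R U x y))) y"
    using linear_continuous_at[OF linear_conv_bounded_linear[THEN iffD1, OF linear_tvec[OF chart_at]]]
    by (rule isCont_o2)
  then show ?thesis by (simp add: tvec_tcomp[OF chart_at])
qed

lemma R_continuous: "continuous_on UNIV (R x)"
proof -
  let ?c = "chart_at A x"
  let ?h = "\<lambda>(z, a). R (point ?c z) (tvec A ?c (point ?c z) a)"
  have h: "continuous_on (cimg ?c \<times> UNIV) ?h"
    using retraction chart_at(1) by (auto simp: manifold_retraction_def smooth_into_def)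
  have "continuous_on UNIV (\<lambda>v. (coord ?c x, tcomp A ?c x v))"
    using linear_continuous_on[OF linear_conv_bounded_linear[THEN iffD1, OF linear_tcomp[OF chart_at]]]
    by (intro continuous_on_Pair continuous_on_const)
  then have "continuous_on UNIV (\<lambda>v. ?h (coord ?c x, tcomp A ?c x v))"
    by (rule continuous_on_compose2[OF h]) (use coord_in[OF chart_at] in auto)
  then show ?thesis by (simp add: point_coord[OF chart_at] tvec_tcomp[OF chart_at])
qed

text \<open>Manifold and tangent space are both modelled on the same Euclidean space, so invariance
  of domain applies in each chart: \<open>R x\<close> followed by \<open>coord c\<close> is a left
  inverse there. The images over all charts are then united.\<close>

lemma open_rinv_image: "open (rinv R U x ` {y. (x, y) \<in> W})"
proof -
  let ?V = "{y. (x, y) \<in> W}"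
  have V: "open ?V"
  proof -
    have "continuous_on UNIV (\<lambda>y. (x, y))" by (intro continuous_intros)
    from open_vimage[OF open_W this] show ?thesis by (simp add: vimage_def)
  qed
  let ?g = "\<lambda>c. rinv R U x \<circ> point c" and ?S = "\<lambda>c. coord c ` (cdom c \<inter> ?V)"
  have "open (?g c ` ?S c)" if c: "c \<in> A" for c
  proof (rule invariance_of_domain)
    have "?S c \<subseteq> cimg c" by (auto simp: cimg_def)
    then have "continuous_on (?S c) (point c)"
      using continuous_on_point[OF c] continuous_on_subset by blast
    moreover have "continuous_on (point c ` ?S c) (rinv R U x)"
      by (rule continuous_at_imp_continuous_on) (auto simp: point_coord[OF c] intro: rinv_isCont)
    ultimately show "continuous_on (?S c) (?g c)" by (rule continuous_on_compose)
    show "open (?S c)" using open_coord_image[OF c V] .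
    show "inj_on (?g c) (?S c)"
      by (rule inj_on_inverseI[where g = "\<lambda>v. coord c (R x v)"])
         (auto simp: point_coord[OF c] R_rinv)
  qed
  then have "open (\<Union>c\<in>A. ?g c ` ?S c)" by blast
  moreover have "(\<Union>c\<in>A. ?g c ` ?S c) = rinv R U x ` ?V"
  proof
    show "(\<Union>c\<in>A. ?g c ` ?S c) \<subseteq> rinv R U x ` ?V"
    proof
      fix v assume "v \<in> (\<Union>c\<in>A. ?g c ` ?S c)"
      then obtain c y where "c \<in> A" "y \<in> cdom c" "(x, y) \<in> W" "v = rinv R U x (point c (coord c y))"
        by auto
      then show "v \<in> rinv R U x ` ?V" by (simp add: point_coord)
    qed
    show "rinv R U x ` ?V \<subseteq> (\<Union>c\<in>A. ?g c ` ?S c)"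
    proof
      fix v assume "v \<in> rinv R U x ` ?V"
      then obtain y where y: "v = rinv R U x y" "(x, y) \<in> W" by auto
      then have "v \<in> ?g (chart_at A y) ` ?S (chart_at A y)"
        using chart_at[of y] by (auto simp: image_image point_coord intro!: image_eqI[of _ _ y])
      then show "v \<in> (\<Union>c\<in>A. ?g c ` ?S c)" using chart_at(1) by blast
    qed
  qed
  ultimately show ?thesis by simp
qed

text \<open>\<open>U x\<close> need not be star-shaped, so the segment from \<open>0\<close> to \<open>rinv R U x u\<close> could leave it. It does
  not: the parameters for which the claim holds form a closed subset of the unit interval, which is
  also open because $R_x^{-1}$ is an open map by invariance of domain.\<close>

lemma rinv_R_scaleR:
  assumes "x \<in> X" "u \<in> X" "s \<in> {0..1}"
  shows "rinv R U x (R x (s *\<^sub>R rinv R U x u)) = s *\<^sub>R rinv R U x u"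
proof -
  define d where "d = rinv R U x u"
  define Q where "Q = rinv R U x ` {y. (x, y) \<in> W}"
  define T where "T = {s \<in> {0..1::real}. rinv R U x (R x (s *\<^sub>R d)) - s *\<^sub>R d = 0}"
  \<comment> \<open>R-convexity keeps the whole curve in \<open>X\<close>, so the inverse retraction
    is defined along it.\<close>
  have W: "(x, R x (s *\<^sub>R d)) \<in> W" if "s \<in> {0..1}" for s
    using R_step_in[OF assms(1,2) that] X_subset_W assms(1) unfolding d_def by blast
  \<comment> \<open>As a zero set \<open>T\<close> is relatively closed; as a preimage of the open
    set \<open>Q\<close> it is relatively open. If \<open>s *\<^sub>R d\<close> equals
    \<open>rinv R U x y\<close> with \<open>(x, y) \<in> W\<close>, then \<open>y\<close> must be
    \<open>R x (s *\<^sub>R d)\<close>.\<close>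
  have T_eq: "T = {0..1} \<inter> (\<lambda>s. s *\<^sub>R d) -` Q"
  proof (intro equalityI subsetI)
    fix s assume "s \<in> T"
    then have s: "s \<in> {0..1}" "s *\<^sub>R d = rinv R U x (R x (s *\<^sub>R d))" by (auto simp: T_def)
    with W have "s *\<^sub>R d \<in> Q" unfolding Q_def by blast
    with s show "s \<in> {0..1} \<inter> (\<lambda>s. s *\<^sub>R d) -` Q" by blast
  next
    fix s assume s: "s \<in> {0..1} \<inter> (\<lambda>s. s *\<^sub>R d) -` Q"
    then obtain y where "s *\<^sub>R d = rinv R U x y" "(x, y) \<in> W" by (auto simp: Q_def)
    with s show "s \<in> T" by (simp add: T_def R_rinv)
  qed
  have "open Q" using open_rinv_image by (simp add: Q_def)
  moreover have "continuous_on {0..1} (\<lambda>s. s *\<^sub>R d)" by (intro continuous_intros)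
  ultimately have "openin (top_of_set {0..1}) T"
    unfolding T_eq using continuous_openin_preimage_gen by blast
  moreover have "closedin (top_of_set {0..1}) T"
    unfolding T_def
  proof (rule continuous_closedin_preimage_constant)
    have "continuous_on {0..1} (\<lambda>s. R x (s *\<^sub>R d))"
      by (rule continuous_on_compose2[OF R_continuous]) (auto intro!: continuous_intros)
    moreover have "continuous_on ((\<lambda>s. R x (s *\<^sub>R d)) ` {0..1}) (rinv R U x)"
      by (rule continuous_at_imp_continuous_on) (auto intro!: rinv_isCont W)
    ultimately have "continuous_on {0..1} (\<lambda>s. rinv R U x (R x (s *\<^sub>R d)))"
      by (rule continuous_on_compose[unfolded o_def])
    then show "continuous_on {0..1} (\<lambda>s. rinv R U x (R x (s *\<^sub>R d)) - s *\<^sub>R d)"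
      by (intro continuous_intros)
  qed
  ultimately have "T = {} \<or> T = {0..1}"
    using connected_clopen[THEN iffD1, OF connected_Icc] by blast
  moreover have "R x 0 = x" using retraction by (simp add: manifold_retraction_def)
  then have "0 \<in> T" by (simp add: T_def rinv_self)
  ultimately have "s \<in> T" using assms(3) by blast
  then show ?thesis by (simp add: T_def d_def)
qed

text \<open>Supplies a bound for the search directions, whose target points \<open>p k\<close> need
  not be iterates. Locally, \<open>rnorm\<close> is at most a constant times the norm of the
  components in a fixed chart, and these components are jointly continuous.\<close>

lemma rnorm_rinv_bounded:
  assumes "compact X"
  obtains M where "0 < M" "\<And>x y. x \<in> X \<Longrightarrow> y \<in> X \<Longrightarrow> rnorm G x (rinv R U x y) \<le> M"
proof -
  have "bdd_above ((\<lambda>(x, y). rnorm G x (rinv R U x y)) ` (X \<times> X))"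
  proof (rule compact_imp_bdd_above_image_if_locally)
    fix q assume "q \<in> X \<times> X"
    then obtain x y where q: "q = (x, y)" "(x, y) \<in> W" using X_subset_W by blast
    let ?c = "chart_at A x"
    let ?t = "\<lambda>(x, y). tcomp A ?c x (rinv R U x y)"
    obtain m M where "0 < M" and ev: "\<forall>\<^sub>F y in nhds x. \<forall>v. m * norm (tcomp A ?c y v) \<le> rnorm G y v \<and>
        rnorm G y v \<le> M * norm (tcomp A ?c y v)"
      using rnorm_locally_equivalent[OF chart_at] by blast
    have "isCont fst q" by (intro continuous_intros)
    then have "filterlim fst (nhds x) (nhds q)"
      using isCont_imp_tendsto_nhds by (fastforce simp: q)
    from eventually_compose_filterlim[OF ev this]
    have 1: "\<forall>\<^sub>F q in nhds q. \<forall>v. rnorm G (fst q) v \<le> M * norm (tcomp A ?c (fst q) v)"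
      by eventually_elim blast
    have "isCont (\<lambda>p. norm (?t p)) q"
      using tcomp_rinv_isCont[OF chart_at q(2)] unfolding q(1) by (rule isCont_norm)
    then have "\<forall>\<^sub>F p in nhds q. norm (?t p) < norm (?t q) + 1"
      by (rule isCont_eventually_less) simp
    with 1 have "\<forall>\<^sub>F p in nhds q. (\<lambda>(x, y). rnorm G x (rinv R U x y)) p \<le> M * (norm (?t q) + 1)"
    proof eventually_elim
      case (elim p)
      have "(\<lambda>(x, y). rnorm G x (rinv R U x y)) p \<le> M * norm (?t p)"
        using elim(1) by (simp add: case_prod_beta)
      also have "\<dots> \<le> M * (norm (?t q) + 1)"
        using elim(2) \<open>0 < M\<close> by (intro mult_left_mono) auto
      finally show ?case .
    qed
    then show "\<exists>B. \<forall>\<^sub>F p in nhds q. (\<lambda>(x, y). rnorm G x (rinv R U x y)) p \<le> B" by blast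
  qed (use assms compact_Times in blast)
  then obtain M where "\<And>q. q \<in> X \<times> X \<Longrightarrow> (\<lambda>(x, y). rnorm G x (rinv R U x y)) q \<le> M"
    by (auto simp: bdd_above_def)
  \<comment> \<open>The maximum with 1 makes the bound positive.\<close>
  then show thesis
    by (intro that[of "max M 1"]) (fastforce simp: le_max_iff_disj)+
qed

lemma rnorm_rinv_isCont:
  assumes "(x, y) \<in> W"
  shows "isCont (\<lambda>y. rnorm G x (rinv R U x y)) y"
  unfolding rnorm_def
  by (intro continuous_real_sqrt bilinear_continuous_compose[OF _ _ bilinear_metric] rinv_isCont assms)

text \<open>\<open>L_smooth\<close> speaks of the inverse retraction at the new point;
  \<open>rinv_R_scaleR\<close> identifies it with \<open>s *\<^sub>R d\<close>. The linear terms of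
  \<open>f\<close> and \<open>g\<close> then combine into the subproblem objective.\<close>

lemma composite_step_le:
  assumes "L_smooth A G R U L f" "R_convex_fun R U g" "x \<in> X" "u \<in> X" "s \<in> {0..1}"
  defines "d \<equiv> rinv R U x u"
  shows "f (R x (s *\<^sub>R d)) + g (R x (s *\<^sub>R d)) \<le>
    f x + g x + s * rgcg_objective A G R U f g x u + L * (rnorm G x d)\<^sup>2 / 2 * s\<^sup>2"
proof -
  let ?y = "R x (s *\<^sub>R d)"
  have W: "(x, u) \<in> W" "(x, ?y) \<in> W"
    using R_step_in[OF assms(3-5)] X_subset_W assms(3,4) by (auto simp: d_def)
  have "rinv R U x ?y = s *\<^sub>R d"
    unfolding d_def by (rule rinv_R_scaleR[OF assms(3-5)])
  then have "f ?y \<le> f x + G x (rgrad A G f x) (s *\<^sub>R d) + L / 2 * (rnorm G x (s *\<^sub>R d))\<^sup>2"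
    using assms(1) W_defined[OF W(2)] unfolding L_smooth_def by metis
  moreover have "g ?y \<le> (1 - s) * g x + s * g u"
    using assms(2,5) W_defined[OF W(1)] unfolding R_convex_fun_def d_def by blast
  ultimately show ?thesis
    unfolding rgcg_objective_def d_def[symmetric] rnorm_sq bilinear_lmul[OF bilinear_metric]
      bilinear_rmul[OF bilinear_metric]
    by (simp add: algebra_simps power2_eq_square)
qed

end

section \<open>The Armijo backtracking procedure\<close>

lemma armijo_step_bounds:
  assumes "armijo_step \<zeta> \<omega>1 \<omega>2 \<phi> \<phi>0 \<theta> lam" "0 < \<omega>1" "\<omega>1 < \<omega>2" "\<omega>2 < 1" "0 < K"
    and model: "\<And>s. s \<in> {0..1} \<Longrightarrow> \<phi> s \<le> \<phi>0 + s * \<theta> + K / 2 * s\<^sup>2"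
  shows "lam \<in> {0<..1}" "\<phi> lam \<le> \<phi>0 + \<zeta> * lam * \<theta>"
    "min 1 (2 * \<omega>1 * (1 - \<zeta>) / K * (- \<theta>)) \<le> lam"
proof -
  obtain l \<tau> where \<tau>: "\<tau> (0::nat) = 1"
      "\<And>j. j < l \<Longrightarrow> \<not> \<phi> (\<tau> j) \<le> \<phi>0 + \<zeta> * \<tau> j * \<theta> \<and> \<tau> (Suc j) \<in> {\<omega>1 * \<tau> j .. \<omega>2 * \<tau> j}"
    and lam: "\<phi> (\<tau> l) \<le> \<phi>0 + \<zeta> * \<tau> l * \<theta>" "lam = \<tau> l"
    using assms(1) unfolding armijo_step_def by blast
  have \<tau>_range: "\<tau> j \<in> {0<..1}" if "j \<le> l" for j
    using that
  proof (induction j)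
    case (Suc j)
    then have j: "0 < \<tau> j" "\<tau> j \<le> 1" "\<omega>1 * \<tau> j \<le> \<tau> (Suc j)" "\<tau> (Suc j) \<le> \<omega>2 * \<tau> j"
      using \<tau>(2)[of j] by auto
    moreover have "0 < \<omega>1 * \<tau> j" using j assms(2) by simp
    moreover have "\<omega>2 * \<tau> j \<le> 1 * 1" using j assms(2-4) by (intro mult_mono) auto
    ultimately show ?case by simp
  qed (simp add: \<tau>)
  then show "lam \<in> {0<..1}" "\<phi> lam \<le> \<phi>0 + \<zeta> * lam * \<theta>" using lam by auto
  \<comment> \<open>Either the first trial value 1 is accepted, or there is a last rejected value
    \<open>s\<close>. Its failed test contradicts the quadratic model unless \<open>s\<close> is at
    least \<open>2 * (1 - \<zeta>) / K * (- \<theta>)\<close>, and the next trial loses at most the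
    factor \<open>\<omega>1\<close>.\<close>
  show "min 1 (2 * \<omega>1 * (1 - \<zeta>) / K * (- \<theta>)) \<le> lam"
  proof (cases l)
    case 0 then show ?thesis using lam \<tau> by simp
  next
    case (Suc j)
    define s where "s = \<tau> j"
    have s: "0 < s" "s \<le> 1" using \<tau>_range[of j] Suc by (auto simp: s_def)
    have "\<phi>0 + \<zeta> * s * \<theta> < \<phi> s" "\<omega>1 * s \<le> lam" using \<tau>(2)[of j] Suc lam by (auto simp: s_def)
    moreover have "\<phi> s \<le> \<phi>0 + s * \<theta> + K / 2 * s\<^sup>2" using s by (intro model) auto
    ultimately have "s * ((1 - \<zeta>) * (- \<theta>)) \<le> s * (K / 2 * s)"
      by (simp add: algebra_simps power2_eq_square)
    then have "(1 - \<zeta>) * (- \<theta>) \<le> K / 2 * s" using s(1) by (rule mult_left_le_imp_le)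
    then have "2 * (1 - \<zeta>) / K * (- \<theta>) \<le> s" using \<open>0 < K\<close> by (simp add: field_simps)
    then have "\<omega>1 * (2 * (1 - \<zeta>) / K * (- \<theta>)) \<le> \<omega>1 * s" using assms(2) by (intro mult_left_mono) auto
    with \<open>\<omega>1 * s \<le> lam\<close> show ?thesis by (simp add: mult_ac)
  qed
qed

section \<open>Convergence and rate of the conditional gradient method\<close>

theorem theorem4p9:
  fixes A :: "('m::{t2_space,second_countable_topology}, 'e::euclidean_space) chart set"
    and G :: "'m \<Rightarrow> 'e \<Rightarrow> 'e \<Rightarrow> real"
    and R :: "'m \<Rightarrow> 'e \<Rightarrow> 'm" and U :: "'m \<Rightarrow> 'e set"
    and X :: "'m set" and f g F :: "'m \<Rightarrow> real"
    and \<zeta> \<omega>1 \<omega>2 L Lg \<Omega> \<rho> \<gamma> :: real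
    and x p :: "nat \<Rightarrow> 'm" and d :: "nat \<Rightarrow> 'e" and lam :: "nat \<Rightarrow> real"
    and \<theta> :: "'m \<Rightarrow> real"
  assumes manifold: "smooth_atlas A" "riemannian_metric A G"
    and retraction: "manifold_retraction A R" "injectivity_domain R U"
    and X: "compact X" "R_convex_set R U X" "rinv_smooth_over A R U X"
    and f: "Ck_fun A 1 f"
    and g: "closed_fun g" "R_convex_fun R U g" "lower_semicontinuous g"
    and F: "F = (\<lambda>y. f y + g y)"
    and armijo: "0 < \<zeta>" "\<zeta> < 1" "0 < \<omega>1" "\<omega>1 < \<omega>2" "\<omega>2 < 1"
    and sequence: "rgcg_armijo_sequence A G R U f g X \<zeta> \<omega>1 \<omega>2 x p d lam"
    and \<theta>: "\<theta> = rgcg_theta A G R U f g X"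
    and infinite: "\<And>k. \<theta> (x k) < 0"
    and L: "0 < L" "L_smooth A G R U L f"
    and \<Omega>: "0 < \<Omega>" "\<And>i j. rnorm G (x i) (rinv R U (x i) (x j)) \<le> \<Omega>" "rdiam A G X \<le> ennreal \<Omega>"
    and Lg: "0 < Lg" "\<And>y z. y \<in> X \<Longrightarrow> z \<in> X \<Longrightarrow> \<bar>g y - g z\<bar> \<le> Lg * rnorm G y (rinv R U y z)"
    and \<rho>: "\<rho> = (SUP y\<in>X. rnorm G y (rgrad A G f y))"
    and \<gamma>: "\<gamma> = min (1 / ((Lg + \<rho>) * \<Omega>)) (2 * \<omega>1 * (1 - \<zeta>) / (L * \<Omega>\<^sup>2))"
  shows "\<exists>xs\<in>X. (\<lambda>k. F (x k)) \<longlonglongrightarrow> F xs \<and>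
           (\<lambda>k. \<theta> (x k)) \<longlonglongrightarrow> 0 \<and>
           ((\<forall>k. rnorm G (x k) (d k) \<le> \<Omega>) \<longrightarrow>
             (\<forall>N\<ge>1. Min ((\<lambda>k. \<bar>\<theta> (x k)\<bar>) ` {..<N}) \<le> sqrt ((F (x 0) - F xs) / (\<zeta> * \<gamma> * real N))))"
proof -
  obtain W where W: "open W" "X \<times> X \<subseteq> W" "\<And>x y. (x, y) \<in> W \<Longrightarrow> rinv_defined R U x y"
    "\<And>c d. c \<in> A \<Longrightarrow> d \<in> A \<Longrightarrow> smooth_on
           {(z, w). z \<in> cimg c \<and> w \<in> cimg d \<and> (point c z, point d w) \<in> W}
           (\<lambda>(z, w). tcomp A c (point c z) (rinv R U (point c z) (point d w)))"
    using X(3) unfolding rinv_smooth_over_def by blast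
  interpret retraction_over A G R U X W
    by (intro retraction_over.intro riemannian.intro retraction_over_axioms.intro manifold retraction X(2) W)

  have arg_min: "p k \<in> X" "\<forall>u\<in>X. rgcg_objective A G R U f g (x k) (p k) \<le> rgcg_objective A G R U f g (x k) u"
    and d: "d k = rinv R U (x k) (p k)"
    and step: "armijo_step \<zeta> \<omega>1 \<omega>2 (\<lambda>s. F (R (x k) (s *\<^sub>R d k))) (F (x k)) (\<theta> (x k)) (lam k)"
    and x_Suc: "x (Suc k) = R (x k) (lam k *\<^sub>R d k)" for k
    using sequence unfolding rgcg_armijo_sequence_def is_arg_min_linorder F \<theta> by blast+
  have \<theta>_eq: "\<theta> (x k) = rgcg_objective A G R U f g (x k) (p k)" for k
    unfolding \<theta> rgcg_theta_def using arg_min[of k] by (intro cInf_eq_minimum) auto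

  \<comment> \<open>The bound \<open>B\<close> on the direction stays a parameter: it becomes
    \<open>M\<close> for the limits and \<open>\<Omega>\<close> for the step-size bound in the
    rate.\<close>
  have model: "F (R (x k) (s *\<^sub>R d k)) \<le> F (x k) + s * \<theta> (x k) + L * B\<^sup>2 / 2 * s\<^sup>2"
    if "x k \<in> X" "rnorm G (x k) (d k) \<le> B" "s \<in> {0..1}" for k s B
  proof -
    have "F (R (x k) (s *\<^sub>R d k)) \<le> F (x k) + s * \<theta> (x k) + L * (rnorm G (x k) (d k))\<^sup>2 / 2 * s\<^sup>2"
      using composite_step_le[OF L(2) g(2) that(1) arg_min(1) that(3)] unfolding F \<theta>_eq d by simp
    also have "L * (rnorm G (x k) (d k))\<^sup>2 / 2 * s\<^sup>2 \<le> L * B\<^sup>2 / 2 * s\<^sup>2"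
      using L(1) that(2) rnorm_nonneg by (intro mult_right_mono divide_right_mono mult_left_mono power_mono) auto
    finally show ?thesis by simp
  qed
  obtain M where M: "0 < M" "\<And>x y. x \<in> X \<Longrightarrow> y \<in> X \<Longrightarrow> rnorm G x (rinv R U x y) \<le> M"
    using rnorm_rinv_bounded[OF X(1)] by blast
  have bounds: "lam k \<in> {0<..1}" "F (x (Suc k)) \<le> F (x k) + \<zeta> * lam k * \<theta> (x k)"
      "min 1 (2 * \<omega>1 * (1 - \<zeta>) / (L * B\<^sup>2) * (- \<theta> (x k))) \<le> lam k"
    if "x k \<in> X" "rnorm G (x k) (d k) \<le> B" "0 < B" for k B
    using armijo_step_bounds[OF step armijo(3-5), of "L * B\<^sup>2"] model[OF that(1,2)] L(1) that(3)
    by (simp_all add: x_Suc)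
  \<comment> \<open>Feasibility and the step-size range advance together: \<open>x k \<in> X\<close>
    bounds the direction by \<open>M\<close>, hence \<open>lam k\<close> lies in the unit interval,
    hence R-convexity keeps the next iterate in \<open>X\<close>.\<close>
  have x_in: "x k \<in> X" for k
  proof (induction k)
    case 0 then show ?case using sequence by (simp add: rgcg_armijo_sequence_def)
  next
    case (Suc k)
    then have "lam k \<in> {0<..1}" using bounds(1)[of k M] M arg_min(1) by (simp add: d)
    then show ?case unfolding x_Suc d using Suc arg_min(1) by (intro R_step_in) auto
  qed
  have dM: "rnorm G (x k) (d k) \<le> M" for k using M(2) x_in arg_min(1) by (simp add: d)
  note lam = bounds(1)[OF x_in dM M(1)]
  note descent = bounds(2)[OF x_in dM M(1)]
  have "F (x (Suc k)) \<le> F (x k)" for k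
  proof -
    have "\<zeta> * lam k * \<theta> (x k) \<le> 0"
      using lam[of k] infinite[of k] armijo(1) by (intro mult_nonneg_nonpos) auto
    then show ?thesis using descent[of k] by linarith
  qed
  then have dec: "decseq (\<lambda>k. F (x k))" by (rule decseq_SucI)

  obtain xs r where xs: "xs \<in> X" "strict_mono r" "(x \<circ> r) \<longlonglongrightarrow> xs"
    using compact_imp_seq_compact[OF X(1)] x_in unfolding seq_compact_def by metis
  \<comment> \<open>The Lipschitz estimate is taken with base point \<open>xs\<close>, so only the
    second argument of \<open>rinv\<close> varies.\<close>
  have g_lim: "(\<lambda>k. g (x (r k))) \<longlonglongrightarrow> g xs"
  proof -
    have "(\<lambda>k. rnorm G xs (rinv R U xs ((x \<circ> r) k))) \<longlonglongrightarrow> rnorm G xs (rinv R U xs xs)"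
      using isCont_tendsto_compose[OF rnorm_rinv_isCont xs(3)] X_subset_W xs(1) by blast
    then have "(\<lambda>k. Lg * rnorm G xs (rinv R U xs (x (r k)))) \<longlonglongrightarrow> 0"
      by (intro tendsto_mult_right_zero) (simp add: rinv_self)
    then have "(\<lambda>k. g (x (r k)) - g xs) \<longlonglongrightarrow> 0"
    proof (rule Lim_null_comparison[rotated])
      show "\<forall>\<^sub>F k in sequentially. norm (g (x (r k)) - g xs) \<le> Lg * rnorm G xs (rinv R U xs (x (r k)))"
        using Lg(2)[OF xs(1) x_in] by (simp add: abs_minus_commute)
    qed
    then show ?thesis by (rule LIM_zero_cancel)
  qed
  have "(\<lambda>k. f (x (r k))) \<longlonglongrightarrow> f xs"
    using isCont_tendsto_compose[OF C1_isCont[OF f] xs(3)] by simp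
  from tendsto_add[OF this g_lim] have sub: "(\<lambda>k. F (x (r k))) \<longlonglongrightarrow> F xs" by (simp add: F)
  have lower: "F xs \<le> F (x k)" for k
  proof (rule LIMSEQ_le_const2[OF sub])
    have "F (x (r n)) \<le> F (x k)" if "k \<le> n" for n
      using seq_suble[OF xs(2), of n] that by (intro decseqD[OF dec]) linarith
    then show "\<exists>N. \<forall>n\<ge>N. F (x (r n)) \<le> F (x k)" by blast
  qed
  then obtain l where l: "(\<lambda>k. F (x k)) \<longlonglongrightarrow> l"
    using decseq_convergent[OF dec] by metis
  from LIMSEQ_unique[OF LIMSEQ_subseq_LIMSEQ[OF l xs(2), unfolded o_def] sub]
  have F_lim: "(\<lambda>k. F (x k)) \<longlonglongrightarrow> F xs" using l by simp

  have \<theta>_lim: "(\<lambda>k. \<theta> (x k)) \<longlonglongrightarrow> 0"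
  proof -
    \<comment> \<open>The coefficient in the lower bound for \<open>lam k\<close> when the direction
      is bounded by \<open>M\<close>. Multiplying that lower bound by
      \<open>- \<theta> (x k)\<close> produces the minimum treated in
      \<open>tendsto_zero_if_min_le\<close>.\<close>
    define c where "c = 2 * \<omega>1 * (1 - \<zeta>) / (L * M\<^sup>2)"
    have c: "0 < c" using armijo L(1) M(1) by (simp add: c_def)
    have "(\<lambda>k. (F (x k) - F (x (Suc k))) / \<zeta>) \<longlonglongrightarrow> (F xs - F xs) / \<zeta>"
      using armijo(1) by (intro tendsto_intros F_lim LIMSEQ_Suc) auto
    then have "(\<lambda>k. (F (x k) - F (x (Suc k))) / \<zeta>) \<longlonglongrightarrow> 0" by simp
    then have "(\<lambda>k. - \<theta> (x k)) \<longlonglongrightarrow> 0"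
    proof (rule tendsto_zero_if_min_le[OF _ c])
      fix k
      show "0 \<le> - \<theta> (x k)" using infinite[of k] by simp
      have "min (- \<theta> (x k)) (c * (- \<theta> (x k))\<^sup>2) = min 1 (c * (- \<theta> (x k))) * (- \<theta> (x k))"
        using infinite[of k] by (simp add: min_mult_distrib_right power2_eq_square mult.assoc)
      also have "\<dots> \<le> lam k * (- \<theta> (x k))"
        using bounds(3)[OF x_in dM M(1), of k] infinite[of k] unfolding c_def
        by (intro mult_right_mono) auto
      also have "\<dots> \<le> (F (x k) - F (x (Suc k))) / \<zeta>"
        using descent[of k] armijo(1) by (simp add: field_simps)
      finally show "min (- \<theta> (x k)) (c * (- \<theta> (x k))\<^sup>2) \<le> (F (x k) - F (x (Suc k))) / \<zeta>" .
    qed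
    from tendsto_minus[OF this] show ?thesis by simp
  qed

  have rate: "Min ((\<lambda>k. \<bar>\<theta> (x k)\<bar>) ` {..<N}) \<le> sqrt ((F (x 0) - F xs) / (\<zeta> * \<gamma> * real N))"
    if d\<Omega>: "\<And>k. rnorm G (x k) (d k) \<le> \<Omega>" and N: "1 \<le> N" for N
  proof -
    \<comment> \<open>A real supremum is an upper bound only for a set that is bounded above, so
      this precedes any use of \<open>\<rho>\<close>.\<close>
    have "bdd_above ((\<lambda>y. rnorm G y (rgrad A G f y)) ` X)"
      using X(1) rnorm_rgrad_locally_bounded[OF f] by (intro compact_imp_bdd_above_image_if_locally)
    then have grad_le: "rnorm G y (rgrad A G f y) \<le> \<rho>" if "y \<in> X" for y
      unfolding \<rho> using that by (intro cSUP_upper)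
    have \<rho>0: "0 \<le> \<rho>" using grad_le[OF x_in[of 0]] rnorm_nonneg order_trans by blast
    define b where "b = (Lg + \<rho>) * \<Omega>"
    define c where "c = 2 * \<omega>1 * (1 - \<zeta>) / (L * \<Omega>\<^sup>2)"
    have b: "0 < b" and c: "0 < c" using \<rho>0 \<Omega>(1) Lg(1) L(1) armijo by (simp_all add: b_def c_def)
    have \<gamma>_eq: "\<gamma> = min (1 / b) c" by (simp add: \<gamma> b_def c_def)
    have \<gamma>0: "0 < \<gamma>" using b c by (simp add: \<gamma>_eq)
    \<comment> \<open>Cauchy-Schwarz bounds the linear part and the Lipschitz property bounds the
      difference of \<open>g\<close>. This explains the first entry of the minimum defining
      \<open>\<gamma>\<close>: it makes \<open>\<gamma> * (- \<theta> (x k))\<close> at most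
      1.\<close>
    have \<theta>_le: "- \<theta> (x k) \<le> b" for k
    proof -
      have "- \<theta> (x k) \<le> \<bar>G (x k) (rgrad A G f (x k)) (d k)\<bar> + \<bar>g (x k) - g (p k)\<bar>"
        by (simp add: \<theta>_eq rgcg_objective_def d)
      also have "\<dots> \<le> rnorm G (x k) (rgrad A G f (x k)) * rnorm G (x k) (d k) + Lg * rnorm G (x k) (d k)"
        using Lg(2)[OF x_in arg_min(1)] unfolding d by (intro add_mono metric_Cauchy_Schwarz) auto
      also have "\<dots> \<le> \<rho> * \<Omega> + Lg * \<Omega>"
        using grad_le[OF x_in] d\<Omega> \<rho>0 Lg(1) rnorm_nonneg by (intro add_mono mult_mono) auto
      finally show ?thesis by (simp add: b_def algebra_simps)
    qed
    \<comment> \<open>The two entries of \<open>\<gamma>\<close> match the two entries of the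
      step-size bound, so \<open>\<gamma> * (- \<theta> (x k)) \<le> lam k\<close>; inserting this
      into the Armijo decrease makes it quadratic in \<open>\<theta> (x k)\<close>.\<close>
    have key: "\<zeta> * \<gamma> * (\<theta> (x k))\<^sup>2 \<le> F (x k) - F (x (Suc k))" for k
    proof -
      have "\<gamma> * (- \<theta> (x k)) \<le> min (1 / b) c * (- \<theta> (x k))" by (simp add: \<gamma>_eq)
      also have "\<dots> \<le> min 1 (c * (- \<theta> (x k)))"
      proof (rule min.boundedI)
        have "min (1 / b) c * (- \<theta> (x k)) \<le> 1 / b * b"
          using b c \<theta>_le[of k] infinite[of k] by (intro mult_mono) auto
        then show "min (1 / b) c * (- \<theta> (x k)) \<le> 1" using b by simp
        show "min (1 / b) c * (- \<theta> (x k)) \<le> c * (- \<theta> (x k))"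
          using infinite[of k] by (intro mult_right_mono) auto
      qed
      also have "\<dots> \<le> lam k" using bounds(3)[OF x_in d\<Omega> \<Omega>(1), of k] by (simp add: c_def)
      finally have "\<gamma> * (- \<theta> (x k)) * (\<zeta> * (- \<theta> (x k))) \<le> lam k * (\<zeta> * (- \<theta> (x k)))"
        using infinite[of k] armijo(1) by (intro mult_right_mono) (auto intro: mult_nonneg_nonpos)
      then show ?thesis using descent[of k] by (simp add: power2_eq_square algebra_simps)
    qed
    define \<mu> where "\<mu> = Min ((\<lambda>k. \<bar>\<theta> (x k)\<bar>) ` {..<N})"
    have fin: "finite ((\<lambda>k. \<bar>\<theta> (x k)\<bar>) ` {..<N})" "(\<lambda>k. \<bar>\<theta> (x k)\<bar>) ` {..<N} \<noteq> {}"
      using N by (auto simp: lessThan_empty_iff)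
    have \<mu>0: "0 \<le> \<mu>" using fin by (auto simp: \<mu>_def)
    \<comment> \<open>Each of the first \<open>N\<close> decreases is at least
      \<open>\<zeta> * \<gamma> * \<mu>\<^sup>2\<close>, while their telescoping sum is at most
      \<open>F (x 0) - F xs\<close>.\<close>
    have "\<zeta> * \<gamma> * real N * \<mu>\<^sup>2 = (\<Sum>k<N. \<zeta> * \<gamma> * \<mu>\<^sup>2)" by simp
    also have "\<dots> \<le> (\<Sum>k<N. F (x k) - F (x (Suc k)))"
    proof (rule sum_mono)
      fix k assume "k \<in> {..<N}"
      then have "\<mu> \<le> \<bar>\<theta> (x k)\<bar>" using fin by (auto simp: \<mu>_def)
      then have "\<mu>\<^sup>2 \<le> (\<theta> (x k))\<^sup>2" using \<mu>0 by (metis power2_abs power_mono)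
      then have "\<zeta> * \<gamma> * \<mu>\<^sup>2 \<le> \<zeta> * \<gamma> * (\<theta> (x k))\<^sup>2" using armijo(1) \<gamma>0 by (intro mult_left_mono) auto
      also note key
      finally show "\<zeta> * \<gamma> * \<mu>\<^sup>2 \<le> F (x k) - F (x (Suc k))" .
    qed
    also have "\<dots> = F (x 0) - F (x N)" by (rule sum_lessThan_telescope')
    also have "\<dots> \<le> F (x 0) - F xs" using lower[of N] by simp
    finally have "\<mu>\<^sup>2 \<le> (F (x 0) - F xs) / (\<zeta> * \<gamma> * real N)"
      using armijo(1) \<gamma>0 N by (simp add: field_simps)
    then show ?thesis unfolding \<mu>_def[symmetric] by (rule real_le_rsqrt)
  qed
  show ?thesis using xs(1) F_lim \<theta>_lim rate by blast
qed

end
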